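(* Let $T:\mathbb{T}\to\mathbb{T}$, $T(x)=qx \bmod 1$ for an integer $q\ge 2$, and let $f=\log|\varphi|$, where $\varphi:\mathbb{T}\to\mathbb{R}$ is a (real) analytic function having a finite number of zeros. Then $$\sup_{\mu\in\mathcal{M}_T}\int\log|\varphi|\,d\mu=\sup_{\mu\in\mathcal{P}_T}\int\log|\varphi|\,d\mu,$$ where $\mathcal{M}_T$ is the set of all $T$-invariant Borel probability measures on $\mathbb{T}$ and $\mathcal{P}_T$ is the set of all $T$-invariant probability measures supported on periodic orbits of $T$.
   Context: $\mathbb{T}=\mathbb{R}/\mathbb{Z}$. Integrals of $\log|\varphi|$ may take the value $-\infty$. *)

theory Defs
  imports "HOL-Probability.Probability"
begin

text \<open>The circle R/Z is represented by the fundamental domain [0,1) inside the reals.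
  The map T x = q x mod 1 is taken as frac (q * x), defined on all reals, with values in [0,1).\<close>

definition times_mod1 :: "int \<Rightarrow> real \<Rightarrow> real" where
  "times_mod1 q x = frac (real_of_int q * x)"

definition real_analytic :: "(real \<Rightarrow> real) \<Rightarrow> bool" where
  "real_analytic \<phi> \<longleftrightarrow>
     (\<forall>x. \<exists>r>0. \<exists>c :: nat \<Rightarrow> real. \<forall>y. \<bar>y - x\<bar> < r \<longrightarrow> (\<lambda>n. c n * (y - x) ^ n) sums \<phi> y)"

text \<open>Integral of log|phi| with respect to M, as an extended real (may be -infinity):
  positive part minus negative part, where log 0 = -infinity.\<close>
definition log_abs_integral :: "real measure \<Rightarrow> (real \<Rightarrow> real) \<Rightarrow> ereal" where
  "log_abs_integral M \<phi> =
     enn2ereal (\<integral>\<^sup>+ x. ennreal (max 0 (ln \<bar>\<phi> x\<bar>)) \<partial>M)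
   - enn2ereal (\<integral>\<^sup>+ x. (if \<phi> x = 0 then \<infinity> else ennreal (max 0 (- ln \<bar>\<phi> x\<bar>))) \<partial>M)"

definition invariant_measures :: "(real \<Rightarrow> real) \<Rightarrow> real measure set" where
  "invariant_measures T =
     {M. sets M = sets borel \<and> prob_space M \<and> emeasure M {0..<1} = 1
         \<and> T \<in> borel_measurable borel \<and> distr M borel T = M}"

definition periodic_orbit_measure :: "(real \<Rightarrow> real) \<Rightarrow> real \<Rightarrow> nat \<Rightarrow> real measure" where
  "periodic_orbit_measure T x n =
     distr (uniform_measure (count_space UNIV) {..<n}) borel (\<lambda>k. (T ^^ k) x)"

definition periodic_measures :: "(real \<Rightarrow> real) \<Rightarrow> real measure set" where
  "periodic_measures T =
     {periodic_orbit_measure T x n | x n. x \<in> {0..<1} \<and> n > 0 \<and> (T ^^ n) x = x}"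

end

theory Submission
  imports Defs
begin

text \<open>
  Only the Lipschitz continuity of \<open>\<phi>\<close> matters. If the orbit of \<open>a\<close> nearly returns at time \<open>n\<close>,
  it is shadowed exponentially well (backwards from time \<open>n\<close>) by an \<open>n\<close>-periodic orbit. The sum of
  \<open>ln \<bar>\<phi>\<bar>\<close> changes only by a constant under shadowing, provided time \<open>n\<close> is good: \<open>k\<close> steps before it,
  \<open>\<bar>\<phi>\<bar>\<close> is at least \<open>\<tau> (2/3)\<^sup>k\<close>, for every \<open>k\<close>. Cut the circle into \<open>K\<close> cells. Any orbit segment of
  length \<open>N\<close> splits into at most \<open>K\<close> loops between good times in a common cell, plus bad times.
  With \<open>ln \<bar>\<phi>\<bar>\<close> normalised to be nonpositive, this bounds its sum along the segment pointwise by
  \<open>N\<close> times the periodic supremum, up to \<open>O(K)\<close> and a multiple of the number of bad times.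
  Integrate against the invariant measure and let \<open>N \<rightarrow> \<infinity>\<close>: no ergodic theorem is needed.
  By integrability of \<open>ln \<bar>\<phi>\<bar>\<close>, the expected density of bad times vanishes as \<open>\<tau> \<rightarrow> 0\<close>.
\<close>

section \<open>Regularity of \<open>\<phi>\<close> and arithmetic modulo 1\<close>

lemma real_analytic_C1:
  assumes "real_analytic \<phi>"
  obtains D where "\<And>x. (\<phi> has_real_derivative D x) (at x)" "\<And>x. isCont D x"
proof
  have *: "(\<phi> has_real_derivative deriv \<phi> x) (at x) \<and> isCont (deriv \<phi>) x" for x
  proof -
    obtain r c where r: "r > 0"
      and c: "\<And>y. \<bar>y - x\<bar> < r \<Longrightarrow> (\<lambda>n. c n * (y - x) ^ n) sums \<phi> y"
      using assms unfolding real_analytic_def by metis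
    define g where "g = (\<lambda>z. \<Sum>n. c n * z ^ n)"
    define g' where "g' = (\<lambda>z. \<Sum>n. diffs c n * z ^ n)"
    have sm: "summable (\<lambda>n. c n * z ^ n)" if "norm z < r" for z
      using c[of "x + z"] that by (auto simp: sums_iff)
    have near: "\<forall>\<^sub>F y in nhds u. \<bar>y - x\<bar> < r" if "\<bar>u - x\<bar> < r" for u
    proof -
      have "open {y. \<bar>y - x\<bar> < r}" by (intro open_Collect_less continuous_intros)
      then show ?thesis using that by (auto dest: eventually_nhds_in_open)
    qed
    have D: "(\<phi> has_real_derivative g' (y - x)) (at y)" if "\<bar>y - x\<bar> < r" for y
    proof -
      have "(g has_real_derivative g' (y - x)) (at (y - x))"
        unfolding g_def g'_def by (rule termdiffs_strong'[OF sm]) (use that in auto)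
      then have "((\<lambda>y. g (y - x)) has_real_derivative g' (y - x)) (at y)"
        using DERIV_shift[of g "g' (y - x)" y "- x"] by simp
      moreover have "\<forall>\<^sub>F z in nhds y. \<phi> z = g (z - x)"
        using near[OF that] by eventually_elim (use c in \<open>auto simp: g_def sums_iff\<close>)
      ultimately show ?thesis by (subst DERIV_cong_ev[OF refl _ refl])
    qed
    \<comment> \<open>Since \<open>x\<close> is arbitrary, continuity of the derivative is only
      needed at the centre of its expansion. The point \<open>r/2\<close> lies strictly inside the
      disc of convergence, so the differentiated series converges there.\<close>
    have "isCont g' 0"
      unfolding g'_def
      by (rule isCont_powser[of _ "r/2"], rule termdiff_converges[of _ r]) (use r sm in auto)
    then have "isCont (\<lambda>y. g' (y - x)) x"
      using isCont_o2[of x "\<lambda>y. y - x" g'] by simp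
    moreover have "\<forall>\<^sub>F y in nhds x. deriv \<phi> y = g' (y - x)"
      using near[of x] r by (auto elim!: eventually_mono intro!: DERIV_imp_deriv D)
    ultimately have "isCont (deriv \<phi>) x" by (subst isCont_cong)
    with D[of x] r show ?thesis by (auto simp: DERIV_imp_deriv)
  qed
  show "(\<phi> has_real_derivative deriv \<phi> x) (at x)" "isCont (deriv \<phi>) x" for x
    using * by auto
qed

lemma frac_minus_of_int [simp]: "frac (x - of_int k) = frac x"
  by (simp add: frac_def)

text \<open>The two arguments differ by an integer. This is why iterates of the map collapse to a
  single \<open>frac\<close>.\<close>

lemma frac_of_int_mult_frac: "frac (of_int m * frac x) = frac (of_int m * x)"
proof -
  have "of_int m * frac x = of_int m * x - of_int (m * \<lfloor>x\<rfloor>)"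
    by (simp add: frac_def algebra_simps)
  then show ?thesis by (simp only: frac_minus_of_int)
qed

lemma periodic_frac:
  fixes \<phi> :: "real \<Rightarrow> 'a"
  assumes "\<And>x. \<phi> (x + 1) = \<phi> x"
  shows "\<phi> (frac x) = \<phi> x"
proof -
  interpret periodic_fun_simple' \<phi> by unfold_locales (rule assms)
  show ?thesis unfolding frac_def by (rule minus_of_int)
qed

text \<open>The derivative is continuous and 1-periodic, so its bound on the compact interval
  \<open>{0..1}\<close> holds on the whole line and serves as a Lipschitz constant by the mean value
  inequality.\<close>

lemma periodic_real_analytic_lipschitz:
  assumes per: "\<And>x. \<phi> (x + 1) = \<phi> x" and "real_analytic \<phi>"
  obtains L where "L > 0" "\<And>x y. \<bar>\<phi> x - \<phi> y\<bar> \<le> L * \<bar>x - y\<bar>"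
proof -
  obtain D where D: "\<And>x. (\<phi> has_real_derivative D x) (at x)" and contD: "\<And>x. isCont D x"
    using real_analytic_C1[OF assms(2)] by blast
  have perD: "D (x + 1) = D x" for x
  proof (rule DERIV_unique[OF _ D])
    have "((\<lambda>x. \<phi> (x + 1)) has_real_derivative D (x + 1)) (at x)"
      using D[of "x + 1"] DERIV_shift[of \<phi> "D (x + 1)" x 1] by simp
    then show "(\<phi> has_real_derivative D (x + 1)) (at x)" by (simp add: per)
  qed
  have "compact (D ` {0..1})"
    using contD by (intro compact_continuous_image continuous_at_imp_continuous_on) auto
  then obtain L where L: "L > 0" "\<And>x. x \<in> {0..1} \<Longrightarrow> \<bar>D x\<bar> \<le> L"
    by (auto dest!: compact_imp_bounded simp: bounded_pos)
  have bd: "norm (D x) \<le> L" for x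
    using L(2)[of "frac x"] frac_lt_1[of x] periodic_frac[of D, OF perD] by auto
  have "\<bar>\<phi> x - \<phi> y\<bar> \<le> L * \<bar>x - y\<bar>" for x y
    using field_differentiable_bound[of UNIV \<phi> D L x y] D bd by auto
  with L(1) that show ?thesis by blast
qed

section \<open>Iterates of the map and measures on periodic orbits\<close>

lemma times_mod1_measurable [measurable]: "times_mod1 q \<in> borel_measurable borel"
proof -
  have "(\<lambda>x. real_of_int q * x) \<in> borel_measurable borel" by simp
  from borel_measurable_diff[OF this measurable_compose[OF this borel_measurable_real_floor]]
  show ?thesis by (simp add: times_mod1_def[abs_def] frac_def)
qed

lemma funpow_times_mod1:
  assumes "x \<in> {0..<1}"
  shows "(times_mod1 q ^^ n) x = frac (real_of_int q ^ n * x)"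
proof (induction n)
  case 0
  then show ?case using assms by simp
next
  case (Suc n)
  then show ?case
    by (simp add: times_mod1_def frac_of_int_mult_frac mult.assoc)
qed

lemma funpow_times_mod1_bounds:
  assumes "x \<in> {0..<1}"
  shows "(times_mod1 q ^^ n) x \<in> {0..<1}"
  using funpow_times_mod1[OF assms] by (simp add: frac_lt_1)

text \<open>With a pmf in place of the uniform measure, integrals along the orbit become finite
  averages and almost-everywhere statements become finite checks.\<close>

lemma periodic_orbit_measure_eq_pmf:
  assumes "n > 0"
  shows "periodic_orbit_measure T x n = distr (measure_pmf (pmf_of_set {..<n})) borel (\<lambda>k. (T ^^ k) x)"
proof -
  have "uniform_measure (count_space UNIV) {..<n} = measure_pmf (pmf_of_set {..<n})"
  proof (rule measure_eqI)
    fix A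
    have "emeasure (uniform_measure (count_space UNIV) {..<n}) A
        = of_nat (card ({..<n} \<inter> A)) / of_nat n"
      by (simp add: emeasure_count_space)
    also have "\<dots> = emeasure (measure_pmf (pmf_of_set {..<n})) A"
      using assms by (subst emeasure_pmf_of_set)
        (auto simp: divide_ennreal ennreal_of_nat_eq_real_of_nat)
    finally show "emeasure (uniform_measure (count_space UNIV) {..<n}) A
        = emeasure (measure_pmf (pmf_of_set {..<n})) A" .
  qed simp
  then show ?thesis by (simp add: periodic_orbit_measure_def)
qed

lemma emeasure_periodic_orbit_measure:
  assumes "n > 0" "A \<in> sets borel"
  shows "emeasure (periodic_orbit_measure T x n) A = (\<Sum>k<n. indicator A ((T ^^ k) x)) / of_nat n"
proof -
  have "emeasure (periodic_orbit_measure T x n) A = (\<integral>\<^sup>+y. indicator A y \<partial>periodic_orbit_measure T x n)"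
    using assms(2) by (subst nn_integral_indicator) (simp_all add: periodic_orbit_measure_def)
  also have "\<dots> = (\<Sum>k<n. indicator A ((T ^^ k) x)) / of_nat n"
    unfolding periodic_orbit_measure_eq_pmf[OF assms(1)] using assms
    by (subst nn_integral_distr) (auto simp: nn_integral_pmf_of_set lessThan_empty_iff)
  finally show ?thesis .
qed

text \<open>Along a closed orbit, applying \<open>T\<close> shifts the index by one, which only
  moves the first term of the orbit sum to the end.\<close>

lemma periodic_measures_subset_invariant:
  assumes [measurable]: "T \<in> borel_measurable borel" and T: "\<And>x. x \<in> {0..<1} \<Longrightarrow> T x \<in> {0..<1}"
  shows "periodic_measures T \<subseteq> invariant_measures T"
proof
  fix M assume "M \<in> periodic_measures T"
  then obtain x n where M: "M = periodic_orbit_measure T x n"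
    and x: "x \<in> {0..<1}" "n > 0" "(T ^^ n) x = x"
    by (auto simp: periodic_measures_def)
  have sets [simp]: "sets M = sets borel" by (simp add: M periodic_orbit_measure_def)
  have space: "space M = UNIV" using sets_eq_imp_space_eq[OF sets] by simp
  have TM: "T \<in> borel_measurable M" using assms(1) measurable_cong_sets[OF sets refl] by blast
  have orbit: "(T ^^ k) x \<in> {0..<1}" for k by (induction k) (use x T in auto)
  have "prob_space M"
    unfolding M periodic_orbit_measure_eq_pmf[OF x(2)]
    by (intro prob_space.prob_space_distr prob_space_measure_pmf) simp
  moreover have "emeasure M {0..<1} = 1"
    unfolding M using orbit x(2)
    by (subst emeasure_periodic_orbit_measure)
      (auto simp: ennreal_divide_self ennreal_of_nat_eq_real_of_nat indicator_def)
  moreover have "distr M borel T = M"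
  proof (rule measure_eqI)
    fix A assume "A \<in> sets (distr M borel T)"
    then have A [measurable]: "A \<in> sets borel" by simp
    define g where "g k = (indicator A ((T ^^ k) x) :: ennreal)" for k
    have gn: "g n = g 0" by (simp add: g_def x(3))
    have "(\<Sum>k<n. g (Suc k)) = (\<Sum>k<n. g k)"
    proof -
      \<comment> \<open>Cancellation in \<open>ennreal\<close> requires the common summand
        \<open>g 0\<close> to be finite.\<close>
      have "g 0 + (\<Sum>k<n. g (Suc k)) = g 0 + (\<Sum>k<n. g k)"
        using sum.lessThan_Suc_shift[of g n] sum.lessThan_Suc[of g n] gn by (metis add.commute)
      moreover have "g 0 \<noteq> \<top>" by (auto simp: g_def indicator_def)
      ultimately show ?thesis
        unfolding ennreal_add_left_cancel infinity_ennreal_def by blast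
    qed
    moreover have "emeasure (distr M borel T) A = emeasure M (T -` A)"
      using emeasure_distr[OF TM A] space by simp
    moreover have "T -` A \<in> sets borel"
      using measurable_sets[OF assms(1) A] by simp
    then have "emeasure M (T -` A) = (\<Sum>k<n. g (Suc k)) / of_nat n"
      unfolding M by (subst emeasure_periodic_orbit_measure[OF x(2)]) (auto simp: g_def indicator_def)
    moreover have "emeasure M A = (\<Sum>k<n. g k) / of_nat n"
      unfolding M g_def by (rule emeasure_periodic_orbit_measure[OF x(2) A])
    ultimately show "emeasure (distr M borel T) A = emeasure M A"
      by (simp only:)
  qed simp
  ultimately show "M \<in> invariant_measures T" by (simp add: invariant_measures_def)
qed

section \<open>The integral of the logarithm\<close>

text \<open>At a zero of \<open>\<phi>\<close>, \<open>ln 0\<close> is 0 in HOL while the negative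
  part in \<open>log_abs_integral\<close> is infinite. The second assumption makes the two
  conventions agree almost everywhere.\<close>

lemma log_abs_integral_eq_integral:
  assumes "integrable M (\<lambda>x. ln \<bar>\<phi> x\<bar>)" and "AE x in M. \<phi> x \<noteq> 0"
  shows "log_abs_integral M \<phi> = ereal (\<integral>x. ln \<bar>\<phi> x\<bar> \<partial>M)"
proof -
  let ?f = "\<lambda>x. ln \<bar>\<phi> x\<bar>"
  have int: "integrable M (\<lambda>x. max 0 (?f x))" "integrable M (\<lambda>x. max 0 (- ?f x))"
    using assms(1) by auto
  have "(\<integral>\<^sup>+x. (if \<phi> x = 0 then \<infinity> else ennreal (max 0 (- ?f x))) \<partial>M)
      = (\<integral>\<^sup>+x. ennreal (max 0 (- ?f x)) \<partial>M)"
    using assms(2) by (intro nn_integral_cong_AE) auto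
  also have "\<dots> = ennreal (\<integral>x. max 0 (- ?f x) \<partial>M)"
    by (intro nn_integral_eq_integral int) auto
  moreover have "(\<integral>\<^sup>+x. ennreal (max 0 (?f x)) \<partial>M) = ennreal (\<integral>x. max 0 (?f x) \<partial>M)"
    by (intro nn_integral_eq_integral int) auto
  moreover have "(\<integral>x. max 0 (?f x) \<partial>M) - (\<integral>x. max 0 (- ?f x) \<partial>M) = (\<integral>x. ?f x \<partial>M)"
    by (subst Bochner_Integration.integral_diff[symmetric, OF int])
      (auto intro!: Bochner_Integration.integral_cong)
  ultimately show ?thesis
    unfolding log_abs_integral_def by (simp add: integral_nonneg_AE)
qed

text \<open>The upper bound on \<open>\<phi>\<close> makes the positive part finite. An infinite
  negative part would then force the value \<open>-\<infinity>\<close>, so both parts are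
  finite.\<close>

lemma log_abs_integral_finiteD:
  assumes "finite_measure M" and [measurable]: "\<phi> \<in> borel_measurable M"
    and B: "\<And>x. \<bar>\<phi> x\<bar> \<le> exp B" and fin: "log_abs_integral M \<phi> \<noteq> -\<infinity>"
  shows "integrable M (\<lambda>x. ln \<bar>\<phi> x\<bar>)" and "AE x in M. \<phi> x \<noteq> 0"
proof -
  interpret finite_measure M by fact
  let ?P = "\<integral>\<^sup>+x. ennreal (max 0 (ln \<bar>\<phi> x\<bar>)) \<partial>M"
  let ?N = "\<integral>\<^sup>+x. (if \<phi> x = 0 then \<infinity> else ennreal (max 0 (- ln \<bar>\<phi> x\<bar>))) \<partial>M"
  have "ln \<bar>\<phi> x\<bar> \<le> max 0 B" for x
  proof (cases "\<phi> x = 0")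
    case False
    then have "ln \<bar>\<phi> x\<bar> \<le> ln (exp B)" using B by (intro ln_mono) auto
    then show ?thesis by simp
  qed simp
  then have "?P \<le> (\<integral>\<^sup>+x. ennreal (max 0 B) \<partial>M)"
    by (intro nn_integral_mono ennreal_leI) auto
  also have "\<dots> < \<infinity>"
    by (simp add: ennreal_mult_eq_top_iff less_top[symmetric])
  finally have P: "?P < \<infinity>" .
  have N: "?N \<noteq> \<infinity>"
  proof
    assume "?N = \<infinity>"
    moreover obtain p where "?P = ennreal p" "p \<ge> 0"
      using P by (cases ?P) auto
    ultimately have "log_abs_integral M \<phi> = -\<infinity>"
      unfolding log_abs_integral_def by simp
    with fin show False by simp
  qed
  have "AE x in M. (if \<phi> x = 0 then \<infinity> else ennreal (max 0 (- ln \<bar>\<phi> x\<bar>))) \<noteq> \<infinity>"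
    by (rule nn_integral_PInf_AE[OF _ N]) measurable
  then show "AE x in M. \<phi> x \<noteq> 0" by eventually_elim (auto split: if_splits)
  show "integrable M (\<lambda>x. ln \<bar>\<phi> x\<bar>)"
  proof (rule integrableI_bounded)
    have "(\<integral>\<^sup>+x. ennreal (norm (ln \<bar>\<phi> x\<bar>)) \<partial>M)
        \<le> (\<integral>\<^sup>+x. ennreal (max 0 (ln \<bar>\<phi> x\<bar>)) + (if \<phi> x = 0 then \<infinity> else ennreal (max 0 (- ln \<bar>\<phi> x\<bar>))) \<partial>M)"
      by (intro nn_integral_mono) (auto simp: max_def ennreal_neg)
    also have "\<dots> = ?P + ?N" by (rule nn_integral_add) measurable
    also have "\<dots> < \<infinity>" using P N by (simp add: less_top)
    finally show "(\<integral>\<^sup>+x. ennreal (norm (ln \<bar>\<phi> x\<bar>)) \<partial>M) < \<infinity>" .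
  qed measurable
qed

lemma log_abs_integral_periodic:
  assumes [measurable]: "\<phi> \<in> borel_measurable borel"
    and n: "n > 0" and nz: "\<And>k. k < n \<Longrightarrow> \<phi> ((T ^^ k) x) \<noteq> 0"
  shows "log_abs_integral (periodic_orbit_measure T x n) \<phi> = ereal ((\<Sum>k<n. ln \<bar>\<phi> ((T ^^ k) x)\<bar>) / n)"
proof -
  let ?p = "pmf_of_set {..<n}"
  have ne: "{..<n} \<noteq> {}" "finite {..<n}" using n by (auto simp: lessThan_empty_iff)
  note eq = periodic_orbit_measure_eq_pmf[OF n]
  have "integrable (periodic_orbit_measure T x n) (\<lambda>x. ln \<bar>\<phi> x\<bar>)"
    unfolding eq by (subst integrable_distr_eq) (auto intro!: integrable_measure_pmf_finite simp: ne)
  moreover have "AE x in periodic_orbit_measure T x n. \<phi> x \<noteq> 0"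
    unfolding eq using nz ne by (subst AE_distr_iff) (auto simp: AE_measure_pmf_iff)
  moreover have "(\<integral>y. ln \<bar>\<phi> y\<bar> \<partial>periodic_orbit_measure T x n) = (\<Sum>k<n. ln \<bar>\<phi> ((T ^^ k) x)\<bar>) / n"
    unfolding eq using ne by (subst integral_distr) (auto simp: integral_pmf_of_set)
  ultimately show ?thesis by (simp add: log_abs_integral_eq_integral)
qed

section \<open>Splitting an orbit segment into loops\<close>

text \<open>Greedy splitting: from the first good time \<open>t\<close>, jump to the last good time
  \<open>u\<close> in the same cell. The stretch from \<open>t\<close> to \<open>u\<close> is a
  loop, and no later good time visits that cell, so induction on the number of cells applies. Terms
  outside the loops are nonpositive and are dropped.\<close>

lemma sum_le_by_loops:
  fixes F :: "nat \<Rightarrow> real" and cell :: "nat \<Rightarrow> 'c"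
  assumes F: "\<And>i. F i \<le> 0" and b: "b \<le> 0" and C: "C \<ge> 0"
    and loop: "\<And>s t. \<lbrakk>s < t; good t; cell s = cell t\<rbrakk> \<Longrightarrow> sum F {s..<t} \<le> real (t - s) * b + C"
    and "finite S" and "\<And>i. \<lbrakk>s \<le> i; i < N; good i\<rbrakk> \<Longrightarrow> cell i \<in> S" and "s \<le> N"
  shows "sum F {s..<N} \<le> (real (N - s) - real (card {i\<in>{s..<N}. \<not> good i}) - real (card S)) * b
           + real (card S) * C"
  using assms(5-7)
proof (induction "card S" arbitrary: S s)
  case 0
  then have "S = {}" by simp
  with 0 have "{i\<in>{s..<N}. \<not> good i} = {s..<N}" by auto
  with \<open>S = {}\<close> show ?case using F by (simp add: sum_nonpos)
next
  case (Suc m)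
  let ?bad = "\<lambda>s t. {i\<in>{s..<t}. \<not> good i}"
  show ?case
  proof (cases "\<exists>t. s \<le> t \<and> t < N \<and> good t")
    case False
    then have "?bad s N = {s..<N}" by auto
    then have "(real (N - s) - real (card (?bad s N)) - real (card S)) * b + real (card S) * C
        = real (card S) * C - real (card S) * b"
      by simp
    moreover have "\<dots> \<ge> 0"
      using mult_nonneg_nonpos[of "real (card S)" b] mult_nonneg_nonneg[of "real (card S)" C] b C
      by linarith
    moreover have "sum F {s..<N} \<le> 0" using F by (intro sum_nonpos) auto
    ultimately show ?thesis by linarith
  next
    case True
    define t where "t = (LEAST t. s \<le> t \<and> t < N \<and> good t)"
    have t: "s \<le> t" "t < N" "good t"
      using LeastI_ex[OF True] unfolding t_def by auto
    have before: "\<not> good i" if "s \<le> i" "i < t" for i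
      using not_less_Least[of i "\<lambda>t. s \<le> t \<and> t < N \<and> good t"] that t(2) unfolding t_def by auto
    let ?V = "{u. t \<le> u \<and> u < N \<and> good u \<and> cell u = cell t}"
    define u where "u = Max ?V"
    have "finite ?V" "t \<in> ?V" using t by auto
    then have "u \<in> ?V" unfolding u_def by (intro Max_in) blast+
    then have u: "t \<le> u" "u < N" "good u" "cell u = cell t" by simp_all
    have after: "v \<le> u" if "v \<in> ?V" for v
      unfolding u_def using \<open>finite ?V\<close> that by (rule Max_ge)
    have card: "card (S - {cell t}) = m" and ct: "cell t \<in> S"
      using Suc.hyps(2) Suc.prems t by auto
    have IH: "sum F {Suc u..<N} \<le> (real (N - Suc u) - real (card (?bad (Suc u) N)) - real m) * b + real m * C"
    proof -
      have "cell i \<in> S - {cell t}" if "Suc u \<le> i" "i < N" "good i" for i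
        using Suc.prems(2)[of i] after[of i] that t u by auto
      then show ?thesis
        using Suc.hyps(1)[of "S - {cell t}" "Suc u"] Suc.prems(1) u(2) card by simp
    qed
    have mid: "sum F {t..<u} \<le> real (u - t) * b + C"
    proof (cases "t = u")
      case False
      then show ?thesis using loop[OF _ u(3) u(4)[symmetric]] u(1) by simp
    qed (use C in simp)
    have split: "sum F {s..<N} = sum F {s..<t} + sum F {t..<u} + F u + sum F {Suc u..<N}"
      using t u sum.atLeastLessThan_concat[of s t N F] sum.atLeastLessThan_concat[of t u N F]
        sum.atLeast_Suc_lessThan[of u N F] by simp
    \<comment> \<open>Bad times between \<open>t\<close> and \<open>u\<close> are subtracted in the
      claim although the loop covers them, and each cell loses the single time \<open>u\<close>.
      Since \<open>b \<le> 0\<close>, subtracting more only enlarges the bound.\<close>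
    have "?bad s t \<union> ?bad (Suc u) N \<subseteq> ?bad s N" using t u by auto
    then have "card (?bad s t \<union> ?bad (Suc u) N) \<le> card (?bad s N)" by (intro card_mono) auto
    moreover have "card (?bad s t \<union> ?bad (Suc u) N) = card (?bad s t) + card (?bad (Suc u) N)"
      using u t by (intro card_Un_disjoint) auto
    moreover have "?bad s t = {s..<t}" using before by auto
    ultimately have bad: "t - s + card (?bad (Suc u) N) \<le> card (?bad s N)" by simp
    have "real (N - s) - real (card (?bad s N)) - real (card S)
        \<le> real (u - t) + (real (N - Suc u) - real (card (?bad (Suc u) N)) - real m)"
      using bad t u Suc.hyps(2) by linarith
    then have "(real (u - t) + (real (N - Suc u) - real (card (?bad (Suc u) N)) - real m)) * b
        \<le> (real (N - s) - real (card (?bad s N)) - real (card S)) * b"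
      using b by (rule mult_right_mono_neg)
    moreover have "sum F {s..<t} \<le> 0" by (intro sum_nonpos F)
    moreover have "real (card S) * C = C + real m * C"
      using Suc.hyps(2)[symmetric] by (simp add: algebra_simps)
    ultimately show ?thesis
      using IH mid F[of u] unfolding split by (simp add: distrib_right)
  qed
qed

section \<open>Estimates for geometric sums, logarithms and tails\<close>

lemma sum_geometric_le:
  fixes r :: real
  assumes "0 \<le> r" "r < 1"
  shows "(\<Sum>i<n. r ^ (n - i)) \<le> r / (1 - r)"
proof -
  have "(\<Sum>i<n. r ^ (n - i)) = (\<Sum>i<n. r ^ Suc i)"
    by (rule sum.reindex_bij_witness[of _ "\<lambda>i. n - Suc i" "\<lambda>i. n - Suc i"]) (auto simp: Suc_diff_Suc)
  also have "\<dots> = r * (\<Sum>i<n. r ^ i)" by (simp add: sum_distrib_left)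
  also have "\<dots> = r * ((1 - r ^ n) / (1 - r))" using assms by (simp add: sum_gp_strict)
  also have "\<dots> \<le> r / (1 - r)"
    using assms by (auto simp: right_diff_distrib intro!: divide_right_mono)
  finally show ?thesis .
qed

text \<open>The ratio of \<open>\<bar>b\<bar>\<close> to \<open>\<bar>a\<bar>\<close> is at least
  \<open>1 - u\<close> with \<open>u = t / 2\<close>, and
  \<open>ln (1 - u) \<ge> - u - 2 * u\<^sup>2 \<ge> - 2 * u\<close> for \<open>u\<close> between 0
  and \<open>1/2\<close>.\<close>

lemma ln_ge_of_dist_le:
  fixes a b t :: real
  assumes "a \<noteq> 0" "\<bar>b - a\<bar> \<le> t / 2 * \<bar>a\<bar>" "0 \<le> t" "t \<le> 1"
  shows "b \<noteq> 0" and "ln \<bar>b\<bar> \<ge> ln \<bar>a\<bar> - t"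
proof -
  have le: "(1 - t / 2) * \<bar>a\<bar> \<le> \<bar>b\<bar>"
    using assms(2) abs_triangle_ineq2[of a b] unfolding left_diff_distrib
    by (simp add: abs_minus_commute)
  have pos: "(1 - t / 2) * \<bar>a\<bar> > 0" using assms by simp
  with le show "b \<noteq> 0" by auto
  have "2 * (t / 2)\<^sup>2 \<le> t / 2"
    using assms mult_left_le[of t t] by (simp add: power2_eq_square)
  then have "- t \<le> ln (1 - t / 2)"
    using ln_one_minus_pos_lower_bound[of "t / 2"] assms by simp
  then have "ln \<bar>a\<bar> - t \<le> ln ((1 - t / 2) * \<bar>a\<bar>)"
    using assms by (subst ln_mult) auto
  also have "\<dots> \<le> ln \<bar>b\<bar>" using le pos by (intro ln_mono) auto
  finally show "ln \<bar>b\<bar> \<ge> ln \<bar>a\<bar> - t" .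
qed

text \<open>Dominated convergence with majorant \<open>\<bar>f\<bar>\<close>; at each point the
  integrand is eventually 0. Applied to \<open>ln \<bar>\<phi>\<bar>\<close>, this makes bad times
  rare for small thresholds.\<close>

lemma integral_tail_tendsto_0:
  fixes f :: "'a \<Rightarrow> real"
  assumes "integrable M f"
  shows "(\<lambda>m. \<integral>x. max 0 (- real m - f x) \<partial>M) \<longlonglongrightarrow> 0"
proof -
  have [measurable]: "f \<in> borel_measurable M" using assms by auto
  have "(\<lambda>m. \<integral>x. max 0 (- real m - f x) \<partial>M) \<longlonglongrightarrow> (\<integral>x. 0 \<partial>M)"
  proof (rule integral_dominated_convergence[where w = "\<lambda>x. \<bar>f x\<bar>"])
    show "AE x in M. (\<lambda>m. max 0 (- real m - f x)) \<longlonglongrightarrow> 0"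
    proof (intro AE_I2 tendsto_eventually)
      fix x
      show "\<forall>\<^sub>F m in sequentially. max 0 (- real m - f x) = 0"
        using eventually_ge_at_top[of "nat \<lceil>- f x\<rceil>"]
        by eventually_elim linarith
    qed
  qed (use assms in auto)
  then show ?thesis by simp
qed

section \<open>Counting bad times\<close>

text \<open>After taking logarithms the condition is linear in \<open>k\<close> and bounds it from
  above: a small value \<open>a\<close> spoils only a limited number of the times after it.\<close>

lemma card_geometric_threshold_le:
  fixes a \<tau> \<theta> :: real
  assumes "a > 0" "\<tau> > 0" "0 < \<theta>" "\<theta> < 1"
  shows "real (card {k\<in>{1..n}. a < \<tau> * \<theta> ^ k}) \<le> max 0 (ln \<tau> - ln a) / - ln \<theta>"
proof -
  have l: "- ln \<theta> > 0" using assms by simp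
  have "k \<le> nat \<lfloor>max 0 (ln \<tau> - ln a) / - ln \<theta>\<rfloor>" if "a < \<tau> * \<theta> ^ k" for k
  proof -
    have "ln a < ln (\<tau> * \<theta> ^ k)" using that assms by (subst ln_less_cancel_iff) auto
    also have "\<dots> = ln \<tau> + real k * ln \<theta>" using assms by (simp add: ln_mult ln_realpow)
    finally have "real k * - ln \<theta> \<le> max 0 (ln \<tau> - ln a)" by simp
    then have "real k \<le> max 0 (ln \<tau> - ln a) / - ln \<theta>" using l by (subst pos_le_divide_eq)
    then show ?thesis by (simp add: le_nat_floor)
  qed
  then have "card {k\<in>{1..n}. a < \<tau> * \<theta> ^ k} \<le> card {1..nat \<lfloor>max 0 (ln \<tau> - ln a) / - ln \<theta>\<rfloor>}"
    by (intro card_mono) auto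
  moreover have "0 \<le> max 0 (ln \<tau> - ln a) / - ln \<theta>" using l by (intro divide_nonneg_pos) auto
  ultimately show ?thesis by (simp add: le_nat_iff le_floor_iff)
qed

text \<open>Every bad time \<open>j\<close> is charged to an earlier time \<open>i\<close> that
  spoils it, and the number of times spoiled by each \<open>i\<close> is bounded by
  \<open>card_geometric_threshold_le\<close>.\<close>

lemma card_bad_times_le:
  fixes a :: "nat \<Rightarrow> real"
  assumes "\<And>i. a i > 0" "\<tau> > 0" "0 < \<theta>" "\<theta> < 1"
  shows "real (card {j\<in>{..<N}. \<exists>i<j. a i < \<tau> * \<theta> ^ (j - i)})
      \<le> (\<Sum>i<N. max 0 (ln \<tau> - ln (a i)) / - ln \<theta>)"
proof -
  define K where "K i = {k\<in>{1..N}. a i < \<tau> * \<theta> ^ k}" for i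
  have "{j\<in>{..<N}. \<exists>i<j. a i < \<tau> * \<theta> ^ (j - i)} \<subseteq> (\<Union>i<N. (+) i ` K i)"
  proof
    fix j assume "j \<in> {j\<in>{..<N}. \<exists>i<j. a i < \<tau> * \<theta> ^ (j - i)}"
    then obtain i where "i < j" "j < N" "a i < \<tau> * \<theta> ^ (j - i)" by auto
    then have "i < N" "j - i \<in> K i" "j = i + (j - i)" by (auto simp: K_def)
    then show "j \<in> (\<Union>i<N. (+) i ` K i)" by blast
  qed
  then have "card {j\<in>{..<N}. \<exists>i<j. a i < \<tau> * \<theta> ^ (j - i)} \<le> card (\<Union>i<N. (+) i ` K i)"
    by (intro card_mono) (auto simp: K_def)
  also have "\<dots> \<le> (\<Sum>i<N. card ((+) i ` K i))" by (intro card_UN_le) simp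
  also have "\<dots> = (\<Sum>i<N. card (K i))" by (intro sum.cong refl card_image) auto
  finally have "real (card {j\<in>{..<N}. \<exists>i<j. a i < \<tau> * \<theta> ^ (j - i)}) \<le> (\<Sum>i<N. real (card (K i)))"
    by (simp flip: of_nat_sum)
  also have "\<dots> \<le> (\<Sum>i<N. max 0 (ln \<tau> - ln (a i)) / - ln \<theta>)"
    unfolding K_def using assms by (intro sum_mono card_geometric_threshold_le) auto
  finally show ?thesis .
qed

section \<open>Shadowing by periodic orbits\<close>

text \<open>On the line, \<open>T ^^ n\<close> lifts near \<open>a\<close> to an affine map of slope
  \<open>Q = q ^ n\<close>, whose fixed point \<open>z\<close> is at distance
  \<open>\<bar>b - a\<bar> / (Q - 1)\<close> from \<open>a\<close>. Up to time \<open>i\<close> this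
  distance grows only by the factor \<open>q ^ i\<close>, leaving it exponentially small in
  \<open>n - i\<close>.\<close>

lemma periodic_shadowing:
  fixes q :: int and \<phi> :: "real \<Rightarrow> real"
  defines "T \<equiv> times_mod1 q"
  assumes q: "q \<ge> 2" and per: "\<And>x. \<phi> (x + 1) = \<phi> x"
    and lip: "\<And>x y. \<bar>\<phi> x - \<phi> y\<bar> \<le> L * \<bar>x - y\<bar>" and L: "L \<ge> 0"
    and a: "a \<in> {0..<1}" and n: "n > 0"
  obtains y where "y \<in> {0..<1}" "(T ^^ n) y = y"
    "\<And>i. i < n \<Longrightarrow> \<bar>\<phi> ((T ^^ i) y) - \<phi> ((T ^^ i) a)\<bar> \<le> 2 * L * \<bar>(T ^^ n) a - a\<bar> * (1/2) ^ (n - i)"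
proof -
  define b where "b = (T ^^ n) a"
  define Q where "Q = real_of_int q ^ n"
  define p where "p = \<lfloor>Q * a\<rfloor>"
  define z where "z = a + (a - b) / (Q - 1)" \<comment> \<open>the fixed point of \<open>u \<mapsto> Q u - p\<close>, the lift of \<open>T\<^sup>n\<close> at \<open>a\<close>\<close>
  have q': "real_of_int q \<ge> 2" using q by simp
  then have "real_of_int q ^ n \<ge> real_of_int q ^ 1" using n by (intro power_increasing) auto
  then have Q: "Q \<ge> 2" using q' unfolding Q_def power_one_right by linarith
  have b: "b = Q * a - of_int p"
    using funpow_times_mod1[OF a] by (simp add: b_def T_def Q_def p_def frac_def)
  have z: "Q * z - of_int p = z"
    using Q unfolding z_def b by (simp add: field_simps)
  have y: "frac z \<in> {0..<1}" by (simp add: frac_lt_1)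
  have step: "frac (real_of_int q ^ i * frac z) = frac (real_of_int q ^ i * z)" for i
    using frac_of_int_mult_frac[of "q ^ i" z] by simp
  have "(T ^^ n) (frac z) = frac (Q * z)"
    using funpow_times_mod1[OF y] step by (simp add: T_def Q_def)
  also have "\<dots> = frac z" using frac_minus_of_int[of "Q * z" p] by (simp add: z)
  finally have fixp: "(T ^^ n) (frac z) = frac z" .
  have "\<bar>\<phi> ((T ^^ i) (frac z)) - \<phi> ((T ^^ i) a)\<bar> \<le> 2 * L * \<bar>b - a\<bar> * (1/2) ^ (n - i)" if "i < n" for i
  proof -
    \<comment> \<open>Comparing lifts on the line instead of points of \<open>{0..<1}\<close> avoids
      the jumps of \<open>frac\<close>; periodicity of \<open>\<phi>\<close> permits this.\<close>
    have "\<phi> ((T ^^ i) (frac z)) = \<phi> (real_of_int q ^ i * z)"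
      "\<phi> ((T ^^ i) a) = \<phi> (real_of_int q ^ i * a)"
      unfolding T_def funpow_times_mod1[OF y] funpow_times_mod1[OF a] step
      by (simp_all add: periodic_frac[of \<phi>, OF per])
    then have "\<bar>\<phi> ((T ^^ i) (frac z)) - \<phi> ((T ^^ i) a)\<bar>
        \<le> L * \<bar>real_of_int q ^ i * z - real_of_int q ^ i * a\<bar>"
      using lip by simp
    also have "real_of_int q ^ i * z - real_of_int q ^ i * a = (a - b) * (real_of_int q ^ i / (Q - 1))"
      by (simp add: z_def algebra_simps)
    also have "\<bar>\<dots>\<bar> = \<bar>b - a\<bar> * (real_of_int q ^ i / (Q - 1))"
      using q' Q by (simp add: abs_mult abs_minus_commute)
    also have "L * \<dots> \<le> L * (\<bar>b - a\<bar> * (2 * (1/2) ^ (n - i)))"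
    proof -
      \<comment> \<open>\<open>Q \<ge> 2\<close> gives \<open>Q - 1 \<ge> Q / 2\<close>, the source
        of the factor 2 in the claim.\<close>
      have "real_of_int q ^ i / (Q - 1) \<le> real_of_int q ^ i / (Q / 2)"
        using q' Q by (intro divide_left_mono mult_pos_pos) auto
      also have "\<dots> = 2 * (1 / real_of_int q) ^ (n - i)"
        using q' that by (simp add: Q_def power_divide power_diff field_simps)
      also have "\<dots> \<le> 2 * (1/2) ^ (n - i)"
        using q' by (intro mult_left_mono power_mono divide_left_mono) auto
      finally show ?thesis using L by (intro mult_left_mono) auto
    qed
    finally show ?thesis by (simp add: mult_ac)
  qed
  then show ?thesis using that[OF y fixp] unfolding b_def by blast
qed

text \<open>The shadowing error is of order \<open>(1/2) ^ (n - i)\<close>, while goodness keeps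
  \<open>\<bar>\<phi>\<bar>\<close> above a multiple of \<open>(2/3) ^ (n - i)\<close>. The relative
  error decays like \<open>(3/4) ^ (n - i)\<close>, so the logarithms lose at most 3 in total,
  whatever \<open>n\<close> is.\<close>

lemma loop_sum_le:
  fixes q :: int and \<phi> :: "real \<Rightarrow> real"
  defines "T \<equiv> times_mod1 q"
  assumes q: "q \<ge> 2" and per: "\<And>x. \<phi> (x + 1) = \<phi> x"
    and lip: "\<And>x y. \<bar>\<phi> x - \<phi> y\<bar> \<le> L * \<bar>x - y\<bar>" and L: "L > 0"
    and \<phi> [measurable]: "\<phi> \<in> borel_measurable borel"
    and \<beta>: "\<And>M. M \<in> periodic_measures T \<Longrightarrow> log_abs_integral M \<phi> \<le> ereal \<beta>"
    and a: "a \<in> {0..<1}" and n: "n > 0" and \<tau>: "\<tau> > 0"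
    and good: "\<And>i. i < n \<Longrightarrow> \<bar>\<phi> ((T ^^ i) a)\<bar> \<ge> \<tau> * (2/3) ^ (n - i)"
    and close: "\<bar>(T ^^ n) a - a\<bar> \<le> \<tau> / (4 * L)"
  shows "(\<Sum>i<n. ln \<bar>\<phi> ((T ^^ i) a)\<bar>) \<le> real n * \<beta> + 3"
proof -
  obtain y where y: "y \<in> {0..<1}" "(T ^^ n) y = y"
    and sh: "\<And>i. i < n \<Longrightarrow> \<bar>\<phi> ((T ^^ i) y) - \<phi> ((T ^^ i) a)\<bar> \<le> 2 * L * \<bar>(T ^^ n) a - a\<bar> * (1/2) ^ (n - i)"
    using periodic_shadowing[of q \<phi> L a n] q per lip L a n unfolding T_def by (metis less_imp_le)
  have near: "\<bar>\<phi> ((T ^^ i) y) - \<phi> ((T ^^ i) a)\<bar> \<le> (3/4) ^ (n - i) / 2 * \<bar>\<phi> ((T ^^ i) a)\<bar>" if "i < n" for i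
  proof -
    \<comment> \<open>The constant in \<open>close\<close> is chosen to give relative error
      \<open>t / 2\<close> with \<open>t = (3/4) ^ (n - i)\<close>, as
      \<open>ln_ge_of_dist_le\<close> requires; \<open>1/2\<close> splits as
      \<open>3/4 * (2/3)\<close>.\<close>
    have "2 * L * \<bar>(T ^^ n) a - a\<bar> * (1/2) ^ (n - i) \<le> 2 * L * (\<tau> / (4 * L)) * (1/2) ^ (n - i)"
      using close L by (intro mult_right_mono mult_left_mono) auto
    also have "\<dots> = \<tau> / 2 * (3/4 * (2/3)) ^ (n - i)" using L by simp
    also have "\<dots> = (3/4) ^ (n - i) / 2 * (\<tau> * (2/3) ^ (n - i))"
      unfolding power_mult_distrib by simp
    also have "\<dots> \<le> (3/4) ^ (n - i) / 2 * \<bar>\<phi> ((T ^^ i) a)\<bar>"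
      using good[OF that] by (intro mult_left_mono) auto
    finally show ?thesis using sh[OF that] by linarith
  qed
  have nz: "\<phi> ((T ^^ i) a) \<noteq> 0" if "i < n" for i
  proof -
    have "0 < \<tau> * (2/3) ^ (n - i)" using \<tau> by simp
    then show ?thesis using good[OF that] by auto
  qed
  have le1: "(3/4 :: real) ^ k \<le> 1" for k by (simp add: power_le_one)
  have nzy: "\<phi> ((T ^^ i) y) \<noteq> 0"
    and ln: "ln \<bar>\<phi> ((T ^^ i) a)\<bar> \<le> ln \<bar>\<phi> ((T ^^ i) y)\<bar> + (3/4) ^ (n - i)" if "i < n" for i
    using ln_ge_of_dist_le[OF nz[OF that] near[OF that]] le1[of "n - i"] by auto
  have "ereal ((\<Sum>i<n. ln \<bar>\<phi> ((T ^^ i) y)\<bar>) / n) \<le> ereal \<beta>"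
  proof -
    have "periodic_orbit_measure T y n \<in> periodic_measures T"
      unfolding periodic_measures_def using y n by blast
    from \<beta>[OF this] show ?thesis
      by (simp only: log_abs_integral_periodic[OF \<phi> n nzy])
  qed
  then have "(\<Sum>i<n. ln \<bar>\<phi> ((T ^^ i) y)\<bar>) \<le> real n * \<beta>"
    using n by (simp add: field_simps)
  moreover have "(\<Sum>i<n. ln \<bar>\<phi> ((T ^^ i) a)\<bar>) \<le> (\<Sum>i<n. ln \<bar>\<phi> ((T ^^ i) y)\<bar> + (3/4) ^ (n - i))"
    by (intro sum_mono ln) auto
  moreover have "(\<Sum>i<n. (3/4 :: real) ^ (n - i)) \<le> 3"
    using sum_geometric_le[of "3/4" n] by simp
  ultimately show ?thesis by (simp add: sum.distrib)
qed

section \<open>From pointwise bounds along orbits to invariant measures\<close>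

lemma orbit_sum_le:
  fixes q :: int and \<phi> :: "real \<Rightarrow> real"
  defines "T \<equiv> times_mod1 q"
  assumes q: "q \<ge> 2" and per: "\<And>x. \<phi> (x + 1) = \<phi> x"
    and lip: "\<And>x y. \<bar>\<phi> x - \<phi> y\<bar> \<le> L * \<bar>x - y\<bar>" and L: "L > 0"
    and \<phi>: "\<phi> \<in> borel_measurable borel"
    and \<beta>: "\<And>M. M \<in> periodic_measures T \<Longrightarrow> log_abs_integral M \<phi> \<le> ereal \<beta>"
    and B: "\<And>x. \<bar>\<phi> x\<bar> \<le> exp B" and \<beta>B: "\<beta> \<le> B" and \<tau>: "\<tau> > 0"
    and x: "x \<in> {0..<1}" and nz: "\<And>i. \<phi> ((T ^^ i) x) \<noteq> 0"
  defines "K \<equiv> real (Suc (nat \<lfloor>4 * L / \<tau>\<rfloor>))"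
  shows "(\<Sum>i<N. ln \<bar>\<phi> ((T ^^ i) x)\<bar> - B)
      \<le> (real N - (\<Sum>i<N. max 0 (ln \<tau> - ln \<bar>\<phi> ((T ^^ i) x)\<bar>) / - ln (2/3)) - K) * (\<beta> - B) + 3 * K"
proof -
  define F where "F i = ln \<bar>\<phi> ((T ^^ i) x)\<bar> - B" for i
  define good where "good j \<longleftrightarrow> (\<forall>i<j. \<bar>\<phi> ((T ^^ i) x)\<bar> \<ge> \<tau> * (2/3) ^ (j - i))" for j
  \<comment> \<open>Cells are intervals of length \<open>\<tau> / (4 * L)\<close>, the return
    distance that \<open>loop_sum_le\<close> admits; \<open>K\<close> is their number.\<close>
  define cell where "cell j = nat \<lfloor>(T ^^ j) x * (4 * L / \<tau>)\<rfloor>" for j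
  define S where "S = {..nat \<lfloor>4 * L / \<tau>\<rfloor>}"
  have c: "4 * L / \<tau> > 0" using L \<tau> by simp
  have orb: "(T ^^ j) x \<in> {0..<1}" for j
    unfolding T_def by (rule funpow_times_mod1_bounds[OF x])
  have F: "F i \<le> 0" for i
  proof -
    have "ln \<bar>\<phi> ((T ^^ i) x)\<bar> \<le> ln (exp B)" using nz B by (intro ln_mono) auto
    then show ?thesis by (simp add: F_def)
  qed
  have cellS: "cell j \<in> S" for j
  proof -
    have "(T ^^ j) x * (4 * L / \<tau>) \<le> 4 * L / \<tau>"
      using orb[of j] c by (intro mult_left_le_one_le) auto
    then show ?thesis unfolding cell_def S_def by (simp add: nat_mono floor_mono)
  qed
  have loop: "sum F {s..<t} \<le> real (t - s) * (\<beta> - B) + 3"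
    if st: "s < t" and "good t" and same: "cell s = cell t" for s t
  proof -
    define a where "a = (T ^^ s) x"
    have it: "(T ^^ i) a = (T ^^ (s + i)) x" for i
      by (simp add: a_def add.commute[of s] funpow_add)
    have "\<lfloor>(T ^^ s) x * (4 * L / \<tau>)\<rfloor> = \<lfloor>(T ^^ t) x * (4 * L / \<tau>)\<rfloor>"
      using same orb[of s] orb[of t] c unfolding cell_def
      by (subst (asm) eq_nat_nat_iff) (auto simp del: times_divide_eq_right)
    then have "\<bar>(T ^^ t) x * (4 * L / \<tau>) - (T ^^ s) x * (4 * L / \<tau>)\<bar> \<le> 1"
      by linarith
    then have "\<bar>(T ^^ t) x - (T ^^ s) x\<bar> * (4 * L / \<tau>) \<le> 1"
      using c by (simp only: abs_mult abs_of_pos flip: left_diff_distrib)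
    then have close: "\<bar>(T ^^ (t - s)) a - a\<bar> \<le> \<tau> / (4 * L)"
      using st L \<tau> by (simp add: it) (simp add: a_def field_simps)
    have "(\<Sum>i<t - s. ln \<bar>\<phi> ((T ^^ i) a)\<bar>) \<le> real (t - s) * \<beta> + 3"
      unfolding T_def
    proof (rule loop_sum_le[OF q per lip L \<phi> \<beta>[unfolded T_def] _ _ \<tau>])
      show "a \<in> {0..<1}" using orb by (simp add: a_def)
      show "0 < t - s" using st by simp
      \<comment> \<open>Goodness of \<open>t\<close> concerns its whole past; time \<open>i\<close>
        of the loop is time \<open>s + i\<close> of the orbit, at the same distance from the
        end.\<close>
      show "\<tau> * (2 / 3) ^ (t - s - i) \<le> \<bar>\<phi> ((times_mod1 q ^^ i) a)\<bar>" if "i < t - s" for i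
        using \<open>good t\<close> that it[of i] unfolding good_def T_def by (auto dest: spec[of _ "s + i"])
      show "\<bar>(times_mod1 q ^^ (t - s)) a - a\<bar> \<le> \<tau> / (4 * L)"
        using close unfolding T_def .
    qed
    moreover have "sum F {s..<t} = (\<Sum>i<t - s. ln \<bar>\<phi> ((T ^^ i) a)\<bar> - B)"
      unfolding F_def it
      by (rule sum.reindex_bij_witness[of _ "\<lambda>i. s + i" "\<lambda>i. i - s"]) auto
    ultimately show ?thesis by (simp add: sum_subtractf algebra_simps)
  qed
  let ?bad = "real (card {i\<in>{0..<N}. \<not> good i})"
  have "sum F {0..<N} \<le> (real (N - 0) - ?bad - real (card S)) * (\<beta> - B) + real (card S) * 3"
    by (rule sum_le_by_loops[where cell = cell]) (use F loop cellS \<beta>B in \<open>auto simp: S_def\<close>)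
  then have le: "sum F {..<N} \<le> (real N - ?bad - K) * (\<beta> - B) + 3 * K"
    by (simp add: S_def K_def lessThan_atLeast0 mult.commute)
  have "?bad = real (card {j\<in>{..<N}. \<exists>i<j. \<bar>\<phi> ((T ^^ i) x)\<bar> < \<tau> * (2/3) ^ (j - i)})"
    unfolding good_def lessThan_atLeast0 by (simp add: not_le)
  also have "\<dots> \<le> (\<Sum>i<N. max 0 (ln \<tau> - ln \<bar>\<phi> ((T ^^ i) x)\<bar>) / - ln (2/3))"
    using nz \<tau> by (intro card_bad_times_le) auto
  \<comment> \<open>Since \<open>\<beta> - B \<le> 0\<close>, overestimating the number of bad times
    weakens the bound.\<close>
  finally have "(real N - ?bad - K) * (\<beta> - B)
      \<le> (real N - (\<Sum>i<N. max 0 (ln \<tau> - ln \<bar>\<phi> ((T ^^ i) x)\<bar>) / - ln (2/3)) - K) * (\<beta> - B)"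
    using \<beta>B by (intro mult_right_mono_neg) auto
  with le show ?thesis unfolding F_def by linarith
qed

lemma distr_funpow:
  assumes [measurable]: "T \<in> borel_measurable borel"
    and M [simp, measurable_cong]: "sets M = sets borel" and inv: "distr M borel T = M"
  shows "distr M borel (T ^^ n) = M"
proof (induction n)
  case 0
  then show ?case by (simp add: distr_id2 id_def)
next
  case (Suc n)
  have "distr M borel (T ^^ Suc n) = distr (distr M borel (T ^^ n)) borel T"
    by (subst distr_distr) (auto intro!: measurable_compose_n)
  also have "\<dots> = M" by (simp add: Suc inv)
  finally show ?case .
qed

text \<open>Integrating \<open>orbit_sum_le\<close> makes both sides affine in \<open>N\<close> by
  invariance. Comparing slopes for fixed \<open>\<tau>\<close>, and then letting
  \<open>\<tau>\<close> tend to 0, gives the claim.\<close>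

lemma invariant_integral_le:
  fixes q :: int and \<phi> :: "real \<Rightarrow> real"
  defines "T \<equiv> times_mod1 q"
  assumes q: "q \<ge> 2" and per: "\<And>x. \<phi> (x + 1) = \<phi> x"
    and lip: "\<And>x y. \<bar>\<phi> x - \<phi> y\<bar> \<le> L * \<bar>x - y\<bar>" and L: "L > 0"
    and \<phi> [measurable]: "\<phi> \<in> borel_measurable borel"
    and \<beta>: "\<And>M. M \<in> periodic_measures T \<Longrightarrow> log_abs_integral M \<phi> \<le> ereal \<beta>"
    and M: "M \<in> invariant_measures T"
  shows "log_abs_integral M \<phi> \<le> ereal \<beta>"
proof (cases "log_abs_integral M \<phi> = -\<infinity>")
  case False
  have sM [simp, measurable_cong]: "sets M = sets borel" and "prob_space M"
    and M1: "emeasure M {0..<1} = 1" and inv: "distr M borel T = M"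
    using M by (auto simp: invariant_measures_def)
  interpret prob_space M by fact
  have T [measurable]: "T \<in> borel_measurable borel" by (simp add: T_def)
  have Tn [measurable]: "T ^^ n \<in> borel_measurable borel" for n by (rule measurable_compose_n) simp
  note inv_n = distr_funpow[OF T sM inv]
  \<comment> \<open>The maximum with \<open>\<beta>\<close> secures
    \<open>\<beta> - B \<le> 0\<close>; the other entry bounds \<open>ln \<bar>\<phi>\<bar>\<close>
    from above.\<close>
  define B where "B = max \<beta> (ln (\<bar>\<phi> 0\<bar> + L))"
  have B: "\<bar>\<phi> x\<bar> \<le> exp B" for x
  proof -
    have "\<bar>\<phi> x\<bar> = \<bar>\<phi> (frac x)\<bar>" using periodic_frac[of \<phi> x, OF per] by simp
    also have "\<dots> \<le> \<bar>\<phi> 0\<bar> + L * \<bar>frac x - 0\<bar>" using lip[of "frac x" 0] by linarith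
    also have "\<dots> \<le> \<bar>\<phi> 0\<bar> + L" using L frac_lt_1[of x] by (simp add: mult_left_le)
    also have "\<dots> = exp (ln (\<bar>\<phi> 0\<bar> + L))" using L by simp
    also have "\<dots> \<le> exp B" by (simp add: B_def)
    finally show ?thesis .
  qed
  have \<beta>B: "\<beta> \<le> B" by (simp add: B_def)
  let ?f = "\<lambda>x. ln \<bar>\<phi> x\<bar>"
  have int: "integrable M ?f" and nz: "AE x in M. \<phi> x \<noteq> 0"
    using log_abs_integral_finiteD[OF _ _ B False] finite_measure_axioms by auto
  have inv_int: "integrable M (\<lambda>x. g ((T ^^ i) x))" "(\<integral>x. g ((T ^^ i) x) \<partial>M) = (\<integral>x. g x \<partial>M)"
    if "integrable M g" for g :: "real \<Rightarrow> real" and i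
  proof -
    have "g \<in> borel_measurable borel"
      using borel_measurable_integrable[OF that] by simp
    then show "integrable M (\<lambda>x. g ((T ^^ i) x))" "(\<integral>x. g ((T ^^ i) x) \<partial>M) = (\<integral>x. g x \<partial>M)"
      using that integrable_distr_eq[of "T ^^ i" M borel g] integral_distr[of "T ^^ i" M borel g]
      by (simp_all add: inv_n)
  qed
  \<comment> \<open>By invariance the preimages of the null set of zeros under all iterates are
    null. There are countably many, so almost every orbit avoids the zeros.\<close>
  have "AE x in M. \<phi> ((T ^^ i) x) \<noteq> 0" for i
  proof (rule AE_distrD[where P = "\<lambda>x. \<phi> x \<noteq> 0"])
    show "T ^^ i \<in> measurable M borel" by simp
    show "AE x in distr M borel (T ^^ i). \<phi> x \<noteq> 0" using nz unfolding inv_n .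
  qed
  then have nz_all: "AE x in M. \<forall>i. \<phi> ((T ^^ i) x) \<noteq> 0" unfolding AE_all_countable by blast
  have "AE x in M. x \<in> {0..<1}"
    using M1 by (intro AE_prob_1) (simp add: measure_def)
  note AE = this nz_all
  define I where "I = (\<integral>x. ?f x \<partial>M)"
  define c where "c = - ln (2/3 :: real)"
  have "c > 0" by (simp add: c_def)
  define H where "H \<tau> = (\<integral>x. max 0 (ln \<tau> - ?f x) / c \<partial>M)" for \<tau>
  have bound: "I - B \<le> (1 - H \<tau>) * (\<beta> - B)" if \<tau>: "\<tau> > 0" for \<tau>
  proof -
    define K where "K = real (Suc (nat \<lfloor>4 * L / \<tau>\<rfloor>))"
    have int_h: "integrable M (\<lambda>x. max 0 (ln \<tau> - ?f x) / c)" using int by auto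
    have "real N * (I - B - (1 - H \<tau>) * (\<beta> - B)) \<le> 3 * K - K * (\<beta> - B)" for N
    proof -
      let ?A = "\<lambda>x. \<Sum>i<N. ?f ((T ^^ i) x) - B"
      let ?h = "\<lambda>x. \<Sum>i<N. max 0 (ln \<tau> - ?f ((T ^^ i) x)) / c"
      have iA: "integrable M ?A" and ih: "integrable M ?h"
        using inv_int(1)[OF int] inv_int(1)[OF int_h] by auto
      have "(\<integral>x. ?A x \<partial>M) \<le> (\<integral>x. (real N - ?h x - K) * (\<beta> - B) + 3 * K \<partial>M)"
      proof (rule integral_mono_AE)
        show "AE x in M. ?A x \<le> (real N - ?h x - K) * (\<beta> - B) + 3 * K"
          using AE
        proof eventually_elim
          case (elim x)
          then show ?case
            using orbit_sum_le[OF q per lip L \<phi> \<beta>[unfolded T_def] B \<beta>B \<tau>, of x N]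
            unfolding K_def c_def T_def by blast
        qed
      qed (use iA ih in auto)
      moreover have "(\<integral>x. ?A x \<partial>M) = real N * (I - B)"
        using inv_int[OF int] by (simp add: Bochner_Integration.integral_sum prob_space I_def)
      moreover have "(\<integral>x. ?h x \<partial>M) = real N * H \<tau>"
        using inv_int[OF int_h] \<open>c > 0\<close> by (simp add: Bochner_Integration.integral_sum H_def)
      then have "(\<integral>x. (real N - ?h x - K) * (\<beta> - B) + 3 * K \<partial>M)
          = (real N - real N * H \<tau> - K) * (\<beta> - B) + 3 * K"
        using ih by (simp add: prob_space)
      ultimately show ?thesis by (simp add: algebra_simps)
    qed
    \<comment> \<open>The bound on the multiples by \<open>N\<close> does not depend on
      \<open>N\<close>, so a positive factor would contradict the Archimedean property.\<close>
    then have "\<not> 0 < I - B - (1 - H \<tau>) * (\<beta> - B)"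
      using reals_Archimedean3 not_le by metis
    then show ?thesis by linarith
  qed
  \<comment> \<open>At \<open>\<tau> = exp (- m)\<close> the threshold \<open>ln \<tau>\<close> is
    \<open>- m\<close>, and \<open>H\<close> is the tail integral divided by
    \<open>c\<close>.\<close>
  have "(\<lambda>m. H (exp (- real m))) \<longlonglongrightarrow> 0"
    using tendsto_divide[OF integral_tail_tendsto_0[OF int] tendsto_const[of c]]
    by (simp add: H_def c_def ln_div)
  then have "(\<lambda>m. (1 - H (exp (- real m))) * (\<beta> - B)) \<longlonglongrightarrow> (1 - 0) * (\<beta> - B)"
    by (intro tendsto_intros)
  then have "I - B \<le> (1 - 0) * (\<beta> - B)"
    by (rule tendsto_lowerbound) (auto intro!: always_eventually bound)
  then show ?thesis
    using log_abs_integral_eq_integral[OF int nz] by (simp add: I_def)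
qed simp

theorem theorem2p1:
  fixes q :: int and \<phi> :: "real \<Rightarrow> real"
  assumes "q \<ge> 2"
    and "\<And>x. \<phi> (x + 1) = \<phi> x"
    and "real_analytic \<phi>"
    and "finite {x \<in> {0..<1}. \<phi> x = 0}"
  shows "(SUP M \<in> invariant_measures (times_mod1 q). log_abs_integral M \<phi>)
       = (SUP M \<in> periodic_measures (times_mod1 q). log_abs_integral M \<phi>)"
proof (rule antisym)
  obtain L where L: "L > 0" "\<And>x y. \<bar>\<phi> x - \<phi> y\<bar> \<le> L * \<bar>x - y\<bar>"
    using periodic_real_analytic_lipschitz[OF assms(2,3)] by blast
  have "continuous_on UNIV \<phi>"
    using real_analytic_C1[OF assms(3)] by (metis DERIV_isCont continuous_at_imp_continuous_on)
  then have \<phi>: "\<phi> \<in> borel_measurable borel" by (rule borel_measurable_continuous_onI)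
  show "(SUP M \<in> invariant_measures (times_mod1 q). log_abs_integral M \<phi>)
      \<le> (SUP M \<in> periodic_measures (times_mod1 q). log_abs_integral M \<phi>)"
  \<comment> \<open>Testing against every real \<open>\<beta>\<close> above the periodic supremum
    covers infinite suprema without a case distinction.\<close>
  proof (rule ereal_le_real, rule SUP_least)
    fix \<beta> M
    assume le: "(SUP M \<in> periodic_measures (times_mod1 q). log_abs_integral M \<phi>) \<le> ereal \<beta>"
      and M: "M \<in> invariant_measures (times_mod1 q)"
    show "log_abs_integral M \<phi> \<le> ereal \<beta>"
      by (rule invariant_integral_le[OF assms(1,2) L(2,1) \<phi> _ M]) (use le in \<open>auto simp: SUP_le_iff\<close>)
  qed
  show "(SUP M \<in> periodic_measures (times_mod1 q). log_abs_integral M \<phi>)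
      \<le> (SUP M \<in> invariant_measures (times_mod1 q). log_abs_integral M \<phi>)"
    by (intro SUP_subset_mono periodic_measures_subset_invariant)
      (auto simp: times_mod1_def[of q] frac_lt_1)
qed

end
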